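(* Let $B : \mathbb{E} \to \mathbb{E}^*$ be self-adjoint positive definite, let $\mu, L > 0$ and $M \ge 0$, and let $f : \mathbb{E} \to \mathbb{R}$ be a twice differentiable function such that $\mu B \preceq \nabla^2 f(x) \preceq L B$ for all $x \in \mathbb{E}$ and $$\nabla^2 f(y) - \nabla^2 f(x) \preceq M \|y - x\|_z \nabla^2 f(w) \qquad \text{for all } x,y,z,w \in \mathbb{E}.$$ Let $x_0 \in \mathbb{E}$ and $\phi_k \in [0,1]$ ($k \ge 0$), and let the sequences $(x_k)$, $(G_k)$, $(u_k)$, $(J_k)$ be generated by $G_0 = L B$ and, for $k \ge 0$, $$x_{k+1} = x_k - G_k^{-1}\nabla f(x_k), \quad u_k = x_{k+1} - x_k, \quad J_k = \int_0^1 \nabla^2 f(x_k + t u_k)\,dt, \quad G_{k+1} = \mathrm{Broyd}_{\phi_k}(J_k, G_k, u_k).$$ Suppose that $$M \lambda_f(x_0) \le \frac{\ln\frac32}{4}\,\frac{\mu}{L}.$$ Let $r_i = \|u_i\|_{x_i}$ for $i \ge 0$, and for $k \ge 0$ let $$\xi_k = e^{M\sum_{i=0}^{k-1} r_i}, \qquad \xi_k' = \left(1 + \frac{M r_k}{2}\right) e^{M \sum_{i=0}^{k-1} r_i}$$ (the empty sum being zero). Then, for all $k \ge 0$, $$\frac{1}{\xi_k}\nabla^2 f(x_k) \preceq G_k \preceq \xi_k \frac{L}{\mu}\nabla^2 f(x_k),$$ $$\frac{1}{\xi_k'} J_k \preceq G_k \preceq \xi_k'\frac{L}{\mu} J_k,$$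 $$\xi_k \lambda_f(x_k) \le \left(1 - \frac{\mu}{2L}\right)^k \lambda_f(x_0),$$ and $\xi_k \le \xi_k' \le \sqrt{\tfrac32}$.
   Context: $\mathbb{E}$ is an $n$-dimensional real vector space with dual $\mathbb{E}^*$, and $\langle s, x\rangle$ is the value of $s \in \mathbb{E}^*$ at $x \in \mathbb{E}$. For self-adjoint linear operators $A, A_1 : \mathbb{E} \to \mathbb{E}^*$, $A \preceq A_1$ means $\langle (A_1 - A) x, x\rangle \ge 0$ for all $x \in \mathbb{E}$. The gradient $\nabla f(x)$ is an element of $\mathbb{E}^*$ and the Hessian $\nabla^2 f(x)$ is a self-adjoint operator $\mathbb{E}\to\mathbb{E}^*$. Notation: $\|h\|_x = \langle \nabla^2 f(x) h, h\rangle^{1/2}$ for $h, x \in \mathbb{E}$, and $\lambda_f(x) = \langle \nabla f(x), \nabla^2 f(x)^{-1}\nabla f(x)\rangle^{1/2}$. For self-adjoint positive definite $A, G : \mathbb{E} \to \mathbb{E}^*$, $u \in \mathbb{E}\setminus\{0\}$ and $\phi \in \mathbb{R}$, define $$\mathrm{Broyd}_\phi(A,G,u) = \phi\left[ G - \frac{A u u^* G + G u u^* A}{\langle A u,u\rangle} + \left(\frac{\langle G u,u\rangle}{\langle A u,u\rangle} + 1\right)\frac{A u u^* A}{\langle A u,u\rangle}\right] + (1-\phi)\left[ G - \frac{G u u^* G}{\langle G u,u\rangle} + \frac{A u u^* A}{\langle A u,u\rangle}\right],$$ where $A u u^* G$ denotes the operator $h \mapsto \langle G u, h\rangle A u$,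 and similarly for the other products; and $\mathrm{Broyd}_\phi(A,G,0) = G$. *)

theory Defs
  imports "HOL-Analysis.Analysis"
begin

(* The space E is a type of class euclidean_space and E* is its dual 'a \<Rightarrow>\<^sub>L real; the inner
   product of the class is never used, its topology is the unique one of a finite-dimensional
   space.  An operator A from E to E* acts by <A x, y> = A x y. *)

type_synonym 'a dual = "'a \<Rightarrow>\<^sub>L real"
type_synonym 'a dual_op = "'a \<Rightarrow>\<^sub>L ('a \<Rightarrow>\<^sub>L real)"

definition self_adjoint :: "'a::euclidean_space dual_op \<Rightarrow> bool" where
  "self_adjoint A \<longleftrightarrow> (\<forall>x y. A x y = A y x)"

definition pos_def :: "'a::euclidean_space dual_op \<Rightarrow> bool" where
  "pos_def A \<longleftrightarrow> (\<forall>x. x \<noteq> 0 \<longrightarrow> A x x > 0)"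

definition loewner_le :: "'a::euclidean_space dual_op \<Rightarrow> 'a dual_op \<Rightarrow> bool"
    (infix "\<preceq>" 50) where
  "A \<preceq> A1 \<longleftrightarrow> (\<forall>x. (A1 - A) x x \<ge> 0)"

(* The inverse is meaningful for bijective A only. *)
definition op_inv :: "'a::euclidean_space dual_op \<Rightarrow> 'a dual \<Rightarrow> 'a" where
  "op_inv A = inv (blinfun_apply A)"

definition gradient :: "('a::euclidean_space \<Rightarrow> real) \<Rightarrow> 'a \<Rightarrow> 'a dual" where
  "gradient f x = Blinfun (frechet_derivative f (at x))"

definition hessian :: "('a::euclidean_space \<Rightarrow> real) \<Rightarrow> 'a \<Rightarrow> 'a dual_op" where
  "hessian f x = Blinfun (frechet_derivative (gradient f) (at x))"

definition twice_differentiable :: "('a::euclidean_space \<Rightarrow> real) \<Rightarrow> bool" where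
  "twice_differentiable f \<longleftrightarrow>
     (\<forall>x. f differentiable (at x)) \<and> (\<forall>x. gradient f differentiable (at x))"

lemma twice_differentiable_gradient:
  "twice_differentiable f \<Longrightarrow> (f has_derivative blinfun_apply (gradient f x)) (at x)"
  unfolding twice_differentiable_def gradient_def
  by (metis bounded_linear_Blinfun_apply frechet_derivative_works has_derivative_bounded_linear)

lemma twice_differentiable_hessian:
  "twice_differentiable f \<Longrightarrow> (gradient f has_derivative blinfun_apply (hessian f x)) (at x)"
  unfolding twice_differentiable_def hessian_def
  by (metis bounded_linear_Blinfun_apply frechet_derivative_works has_derivative_bounded_linear)

definition local_norm :: "('a::euclidean_space \<Rightarrow> real) \<Rightarrow> 'a \<Rightarrow> 'a \<Rightarrow> real" where
  "local_norm f x h = sqrt (hessian f x h h)"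

definition newton_decrement :: "('a::euclidean_space \<Rightarrow> real) \<Rightarrow> 'a \<Rightarrow> real" where
  "newton_decrement f x = sqrt (gradient f x (op_inv (hessian f x) (gradient f x)))"

(* The operator h \<mapsto> <t, h> s.  With s = A u and t = G u it is the product written A u u* G. *)
definition outer :: "'a::euclidean_space dual \<Rightarrow> 'a dual \<Rightarrow> 'a dual_op" where
  "outer s t = blinfun_scaleR_left s o\<^sub>L t"

lemma outer_apply: "outer s t h = t h *\<^sub>R s"
  by (simp add: outer_def)

definition Broyd ::
  "real \<Rightarrow> 'a::euclidean_space dual_op \<Rightarrow> 'a dual_op \<Rightarrow> 'a \<Rightarrow> 'a dual_op" where
  "Broyd \<phi> A G u =
    (if u = 0 then G
     else
       \<phi> *\<^sub>R (G - (1 / A u u) *\<^sub>R (outer (A u) (G u) + outer (G u) (A u))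
                + (G u u / A u u + 1) *\<^sub>R ((1 / A u u) *\<^sub>R outer (A u) (A u)))
       + (1 - \<phi>) *\<^sub>R (G - (1 / G u u) *\<^sub>R outer (G u) (G u)
                       + (1 / A u u) *\<^sub>R outer (A u) (A u)))"

end

theory Submission
  imports Defs
begin

text \<open>
  Measured in the metric of the current Hessian, the quasi-Newton operator \<open>G k\<close> has its spectrum between
  \<open>1 / \<xi> k\<close> and \<open>\<xi> k L / \<mu>\<close>. For \<open>k = 0\<close> this is the choice \<open>G 0 = L B\<close>. A Broyden update with
  parameter in \<open>[0,1]\<close> does not enlarge the spectral interval relative to the operator \<open>J k\<close> that it uses
  (\<open>Broyd_bounds\<close>), so the only loss comes from the change of metric between the Hessian at \<open>x k\<close>, the
  mean Hessian \<open>J k\<close> and the Hessian at \<open>x (Suc k)\<close>. Strong self-concordance bounds each of the two changes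
  by the factor \<open>1 + M r k / 2\<close> (\<open>mean_hessian_bounds\<close>), and the square of this factor is at most
  \<open>exp (M r k)\<close>, the quotient of consecutive values of \<open>\<xi>\<close>.

  The gradient at the new point is the residual \<open>(J k - G k) (u k)\<close>. If the spectrum of \<open>G k\<close> relative to
  \<open>J k\<close> lies in \<open>[1 / \<xi>' k, \<xi>' k L / \<mu>]\<close>, the residual is smaller than the old gradient by the factor
  \<open>max (1 - \<mu> / (\<xi>' k L)) (\<xi>' k - 1)\<close> in the dual norm of \<open>J k\<close> (\<open>dual_norm_residual\<close>). As long as \<open>\<xi>' k\<close>
  is at most \<open>sqrt (3 / 2)\<close> and \<open>M r k\<close> is small compared with \<open>\<mu> / L\<close>, this factor still beats all
  the metric changes, and \<open>\<xi> k\<close> times the Newton decrement shrinks by \<open>1 - \<mu> / (2 L)\<close>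
  (\<open>contraction_factor_bound\<close>).

  The two statements support each other. The step length \<open>r k\<close> is at most \<open>\<xi> k\<close> times the Newton decrement
  (\<open>step_length_le\<close>), so the decrease so far bounds the lengths of the steps so far by a geometric series;
  by the condition on the starting point the sum is so small that \<open>\<xi>' k\<close> stays below
  \<open>sqrt (3 / 2)\<close>. Hence they are proved together by induction on \<open>k\<close>.

  Symmetry of the Hessian is needed throughout, because the Loewner order sees only quadratic forms. It is
  derived from differentiability of the gradient alone (\<open>symmetric_second_derivative\<close>), and continuity of
  the Hessian then follows from self-concordance (\<open>isCont_hessian\<close>).
\<close>

section \<open>Symmetric bilinear forms\<close>

lemma bilinear_dual_op: "bilinear (\<lambda>a b. blinfun_apply (blinfun_apply A a) b)"
  for A :: "'a::euclidean_space dual_op"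
  by (auto simp: bilinear_def linear_iff blinfun.bilinear_simps)

text \<open>
  A symmetric form dominated on the diagonal is dominated off the diagonal: this is Cauchy--Schwarz
  when \<open>T = P\<close>, and in general it turns bounds on a quadratic form into bounds on an operator norm.
  By polarization \<open>2 T(a,b) \<le> P(a,a) + P(b,b)\<close>; replacing \<open>a\<close> by \<open>t a\<close> and choosing the best \<open>t\<close>
  gives the product.
\<close>

lemma symmetric_form_bound:
  fixes T P :: "'a::real_vector \<Rightarrow> 'a \<Rightarrow> real"
  assumes T: "bilinear T" and P: "bilinear P"
    and sym: "\<And>a b. T a b = T b a"
    and le: "\<And>h. \<bar>T h h\<bar> \<le> P h h"
  shows "(T a b)\<^sup>2 \<le> P a a * P b b"
proof -
  note simps = bilinear_ladd[OF T] bilinear_radd[OF T] bilinear_lsub[OF T] bilinear_rsub[OF T]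
    bilinear_ladd[OF P] bilinear_radd[OF P] bilinear_lsub[OF P] bilinear_rsub[OF P]
  have unscaled: "2 * T a b \<le> P a a + P b b" for a b
  proof -
    have "T (a + b) (a + b) - T (a - b) (a - b) \<le> P (a + b) (a + b) + P (a - b) (a - b)"
      using le[of "a + b"] le[of "a - b"] by linarith
    then show ?thesis
      using sym[of a b] by (simp add: simps)
  qed
  have scaled: "2 * (t * T a b) \<le> t\<^sup>2 * P a a + P b b" for t
    using unscaled[of "t *\<^sub>R a" b]
    by (simp add: bilinear_lmul[OF T] bilinear_lmul[OF P] bilinear_rmul[OF P] power2_eq_square mult.assoc)
  have nonneg: "0 \<le> P h h" for h
    using le[of h] by linarith
  show ?thesis
  proof (cases "P a a = 0")
    case True
    have "T a b = 0"
    proof (rule ccontr)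
      assume "T a b \<noteq> 0"
      \<comment> \<open>The scaled inequality is now linear in \<open>t\<close>; this \<open>t\<close> makes its left side \<open>2 (P(b,b) + 1)\<close>.\<close>
      then show False
        using scaled[of "(P b b + 1) / T a b"] True nonneg[of b] by simp
    qed
    then show ?thesis using True by simp
  next
    case False
    then have pos: "P a a > 0" using nonneg[of a] by linarith
    have "2 * ((T a b)\<^sup>2 / P a a) \<le> (T a b)\<^sup>2 / P a a + P b b"
      using scaled[of "T a b / P a a"] pos by (simp add: power2_eq_square)
    then show ?thesis using pos by (simp add: field_simps)
  qed
qed

lemma loewner_le_iff: "A \<preceq> A1 \<longleftrightarrow> (\<forall>h. A h h \<le> A1 h h)"
  by (simp add: loewner_le_def blinfun.bilinear_simps)

lemma pos_def_nonneg: "pos_def A \<Longrightarrow> 0 \<le> A h h"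
  unfolding pos_def_def by (metis blinfun.zero_right order.refl order_less_imp_le)

lemma pos_def_Cauchy_Schwarz:
  assumes "self_adjoint A" and "pos_def A"
  shows "\<bar>A a b\<bar> \<le> sqrt (A a a) * sqrt (A b b)"
proof -
  have "(A a b)\<^sup>2 \<le> A a a * A b b"
    by (rule symmetric_form_bound[OF bilinear_dual_op bilinear_dual_op])
      (use assms in \<open>auto simp: self_adjoint_def pos_def_nonneg\<close>)
  then show ?thesis
    by (metis real_sqrt_abs real_sqrt_le_mono real_sqrt_mult)
qed

section \<open>Inverse operators and dual norms\<close>

text \<open>
  The operator is injective because \<open>A w = 0\<close> forces \<open>A w w = 0\<close>. Reading off the coordinates of
  \<open>A w\<close> on the basis turns it into an endomorphism \<open>T\<close> of the space, for which injectivity implies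
  surjectivity by counting dimensions.
\<close>

lemma pos_def_bij:
  fixes A :: "'a::euclidean_space dual_op"
  assumes "pos_def A"
  shows "bij (blinfun_apply A)"
proof -
  have inj0: "w = 0" if "A w = 0" for w
    using assms that unfolding pos_def_def by fastforce
  define T where "T w = (\<Sum>b\<in>Basis. A w b *\<^sub>R b)" for w
  have T_inner: "T w \<bullet> b = A w b" if "b \<in> Basis" for w b
    using that by (simp add: T_def)
  have T: "linear T"
    by (auto simp: T_def linear_iff blinfun.bilinear_simps scaleR_left_distrib sum.distrib
        scaleR_sum_right)
  have "inj T"
  proof (subst linear_injective_0[OF T], intro allI impI)
    fix w assume "T w = 0"
    then have "A w b = 0" if "b \<in> Basis" for b
      using T_inner[OF that, of w] by simp
    then show "w = 0" by (intro inj0 blinfun_euclidean_eqI) simp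
  qed
  then have surjT: "surj T" using linear_injective_imp_surjective[OF T] by simp
  have "\<exists>w. A w = s" for s
  proof -
    obtain w where w: "T w = (\<Sum>b\<in>Basis. s b *\<^sub>R b)" using surjT by (metis surjD)
    have "A w b = s b" if "b \<in> Basis" for b
      using T_inner[OF that, of w] w that by simp
    then show ?thesis by (metis blinfun_euclidean_eqI)
  qed
  moreover have "inj (blinfun_apply A)"
  proof (rule injI)
    fix v w assume "A v = A w"
    then have "A (v - w) = 0" by (simp add: blinfun.diff_right)
    then show "v = w" using inj0 by fastforce
  qed
  ultimately show ?thesis by (metis bijI surjI)
qed

lemma op_inv_right: "pos_def A \<Longrightarrow> A (op_inv A s) = s"
  unfolding op_inv_def by (simp add: pos_def_bij bij_is_surj surj_f_inv_f)

lemma op_inv_left: "pos_def A \<Longrightarrow> op_inv A (A w) = w"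
  unfolding op_inv_def by (simp add: pos_def_bij bij_is_inj)

text \<open>
  The norm on the dual space that is conjugate to \<open>h \<mapsto> sqrt (A h h)\<close>. The Newton decrement is the
  dual norm of the gradient for \<open>A\<close> the Hessian; the proof also measures gradients in the metric of
  the mean Hessian.
\<close>

definition dual_norm :: "'a::euclidean_space dual_op \<Rightarrow> 'a dual \<Rightarrow> real" where
  "dual_norm A s = sqrt (s (op_inv A s))"

lemma newton_decrement_dual_norm: "newton_decrement f x = dual_norm (hessian f x) (gradient f x)"
  by (simp add: newton_decrement_def dual_norm_def)

lemma dual_norm_apply: "pos_def A \<Longrightarrow> dual_norm A (A w) = sqrt (A w w)"
  by (simp add: dual_norm_def op_inv_left)

lemma dual_norm_nonneg: "pos_def A \<Longrightarrow> 0 \<le> dual_norm A s"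
  by (metis dual_norm_apply op_inv_right pos_def_nonneg real_sqrt_ge_zero)

lemma dual_norm_pairing:
  fixes s :: "'a::euclidean_space dual"
  assumes "self_adjoint A" and "pos_def A"
  shows "\<bar>s v\<bar> \<le> dual_norm A s * sqrt (A v v)"
  using pos_def_Cauchy_Schwarz[OF assms, of "op_inv A s" v] assms(2)
  by (simp add: op_inv_right dual_norm_def)

text \<open>
  For \<open>w = op_inv A' s\<close> the squared dual norm of \<open>s\<close> is the pairing \<open>s w\<close>, which is at most the dual
  norm for \<open>A\<close> times \<open>sqrt (A w w) \<le> sqrt c sqrt (A' w w)\<close>; divide by \<open>sqrt (A' w w)\<close>.
\<close>

lemma dual_norm_antimono:
  fixes A A' :: "'a::euclidean_space dual_op"
  assumes A: "self_adjoint A" "pos_def A" and A': "pos_def A'"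
    and c: "0 \<le> c" and le: "\<And>h. A h h \<le> c * A' h h"
  shows "dual_norm A' s \<le> sqrt c * dual_norm A s"
proof -
  define w where "w = op_inv A' s"
  define d where "d = sqrt (A' w w)"
  have s: "s = A' w" using A' by (simp add: w_def op_inv_right)
  have d: "dual_norm A' s = d" "s w = d * d" "d \<ge> 0"
    using A' by (simp_all add: s d_def dual_norm_apply pos_def_nonneg)
  have "d * d \<le> dual_norm A s * sqrt (A w w)"
    using dual_norm_pairing[OF A, of s w] d by linarith
  also have "\<dots> \<le> dual_norm A s * (sqrt c * d)"
    using real_sqrt_le_mono[OF le[of w]] A
    by (intro mult_left_mono) (auto simp: d_def real_sqrt_mult dual_norm_nonneg)
  finally have "d * d \<le> (sqrt c * dual_norm A s) * d" by (simp add: mult_ac)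
  moreover have "0 \<le> sqrt c * dual_norm A s" using A c by (simp add: dual_norm_nonneg)
  ultimately show ?thesis using d by (metis less_eq_real_def mult_right_le_imp_le)
qed

section \<open>The convex Broyden class preserves spectral bounds\<close>

lemma Broyd_apply:
  assumes "u \<noteq> 0"
  shows "Broyd \<phi> A G u h k =
    \<phi> * (G h k - (G u h * A u k + A u h * G u k) / A u u
         + (G u u / A u u + 1) * (A u h * A u k / A u u))
    + (1 - \<phi>) * (G h k - G u h * G u k / G u u + A u h * A u k / A u u)"
  using assms by (simp add: Broyd_def blinfun.bilinear_simps outer_apply)

lemma Broyd_self_adjoint:
  assumes "self_adjoint A" "self_adjoint G"
  shows "self_adjoint (Broyd \<phi> A G u)"
proof (cases "u = 0")
  case True
  then show ?thesis using assms by (simp add: Broyd_def)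
next
  case False
  then show ?thesis
    using assms unfolding self_adjoint_def Broyd_apply[OF False]
    by (metis (no_types, lifting) add.commute mult.commute)
qed

lemma form_at_difference:
  fixes A :: "'a::euclidean_space dual_op"
  assumes "self_adjoint A"
  shows "A (h - s *\<^sub>R u) (h - s *\<^sub>R u) = A h h - 2 * s * A u h + s\<^sup>2 * A u u"
  using assms by (simp add: self_adjoint_def blinfun.bilinear_simps algebra_simps power2_eq_square)

text \<open>
  Along the line \<open>h - s u\<close> the form \<open>A\<close> is smallest at the \<open>A\<close>-orthogonal projection of \<open>h\<close>, where
  \<open>s = A u h / A u u\<close>.
\<close>

lemma projection_minimal:
  fixes A :: "'a::euclidean_space dual_op"
  assumes "self_adjoint A" "pos_def A" "u \<noteq> 0"
  shows "A h h - (A u h)\<^sup>2 / A u u \<le> A (h - s *\<^sub>R u) (h - s *\<^sub>R u)"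
    and "A (h - (A u h / A u u) *\<^sub>R u) (h - (A u h / A u u) *\<^sub>R u) = A h h - (A u h)\<^sup>2 / A u u"
proof -
  have pos: "A u u > 0" using assms by (simp add: pos_def_def)
  have "0 \<le> A u u * (s - A u h / A u u)\<^sup>2" using pos by simp
  also have "\<dots> = (A u h)\<^sup>2 / A u u - 2 * s * A u h + s\<^sup>2 * A u u"
    using pos by (simp add: power2_eq_square field_simps)
  finally show "A h h - (A u h)\<^sup>2 / A u u \<le> A (h - s *\<^sub>R u) (h - s *\<^sub>R u)"
    by (simp add: form_at_difference[OF assms(1)])
  show "A (h - (A u h / A u u) *\<^sub>R u) (h - (A u h / A u u) *\<^sub>R u) = A h h - (A u h)\<^sup>2 / A u u"
    using pos by (simp add: form_at_difference[OF assms(1)] power2_eq_square field_simps)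
qed

text \<open>
  Both extreme members of the class are, up to the common term \<open>c = (A u h)\<^sup>2 / A u u\<close>, values of
  \<open>G\<close> at a point of the line \<open>h - s u\<close>. The DFP update (\<open>\<phi> = 1\<close>) takes the \<open>A\<close>-projection \<open>v\<close> of \<open>h\<close>,
  and there \<open>A v v + c = A h h\<close>, so the upper bound passes from \<open>G\<close> to it. The BFGS update
  (\<open>\<phi> = 0\<close>) takes the \<open>G\<close>-projection \<open>w\<close>: since this minimizes \<open>G\<close>, BFGS lies below DFP, and since
  \<open>A w w + c \<ge> A h h\<close>, the lower bound passes to it. The conditions \<open>\<alpha> \<le> 1 \<le> \<beta>\<close> make room for the
  term \<open>c\<close>.
\<close>

lemma Broyd_bounds:
  fixes A G :: "'a::euclidean_space dual_op"
  assumes A: "self_adjoint A" "pos_def A" and G: "self_adjoint G" "pos_def G"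
    and \<phi>: "0 \<le> \<phi>" "\<phi> \<le> 1" and \<alpha>: "0 \<le> \<alpha>" "\<alpha> \<le> 1" and \<beta>: "1 \<le> \<beta>"
    and lower: "\<And>h. \<alpha> * A h h \<le> G h h" and upper: "\<And>h. G h h \<le> \<beta> * A h h"
  shows "\<alpha> * A h h \<le> Broyd \<phi> A G u h h" "Broyd \<phi> A G u h h \<le> \<beta> * A h h"
proof -
  have "\<alpha> * A h h \<le> Broyd \<phi> A G u h h \<and> Broyd \<phi> A G u h h \<le> \<beta> * A h h"
  proof (cases "u = 0")
    case True
    then show ?thesis using lower upper by (simp add: Broyd_def)
  next
    case False
    define c where "c = (A u h)\<^sup>2 / A u u"
    define v where "v = h - (A u h / A u u) *\<^sub>R u"
    define w where "w = h - (G u h / G u u) *\<^sub>R u"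
    define D where "D = G v v + c"
    define E where "E = G w w + c"
    have pos: "A u u > 0" "G u u > 0" using A G False by (auto simp: pos_def_def)
    have c: "c \<ge> 0" using pos by (simp add: c_def)
    have Av: "A v v = A h h - c"
      unfolding v_def c_def by (rule projection_minimal(2)[OF A False])
    have Aw: "A h h - c \<le> A w w"
      unfolding w_def c_def by (rule projection_minimal(1)[OF A False])
    have Gw: "G w w = G h h - (G u h)\<^sup>2 / G u u"
      unfolding w_def by (rule projection_minimal(2)[OF G False])
    have Gwv: "G w w \<le> G v v"
      unfolding Gw v_def by (rule projection_minimal(1)[OF G False])
    have Gv: "G v v = G h h - 2 * (A u h * G u h) / A u u + G u u / A u u * c"
      using pos unfolding v_def form_at_difference[OF G(1)] c_def
      by (simp add: power2_eq_square field_simps)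
    have split: "Broyd \<phi> A G u h h = \<phi> * D + (1 - \<phi>) * E"
      using pos unfolding Broyd_apply[OF False] D_def E_def Gw Gv c_def
      by (simp add: power2_eq_square algebra_simps add_divide_distrib)
    have c_scale: "\<alpha> * c \<le> c" "c \<le> \<beta> * c"
      using mult_right_mono[OF \<alpha>(2) c] mult_right_mono[OF \<beta> c] by auto
    have DE: "\<alpha> * A h h \<le> E" "E \<le> D" "D \<le> \<beta> * A h h"
    proof -
      have "\<alpha> * (A h h - c) \<le> G w w"
        using mult_left_mono[OF Aw \<alpha>(1)] lower[of w] by linarith
      then show "\<alpha> * A h h \<le> E" using c_scale unfolding E_def by (simp add: right_diff_distrib)
      show "E \<le> D" using Gwv by (simp add: E_def D_def)
      show "D \<le> \<beta> * A h h"
        using upper[of v] c_scale unfolding D_def Av by (simp add: right_diff_distrib)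
    qed
    have "E \<le> \<phi> * D + (1 - \<phi>) * E" "\<phi> * D + (1 - \<phi>) * E \<le> D"
      using mult_left_mono[OF DE(2) \<phi>(1)] mult_left_mono[OF DE(2), of "1 - \<phi>"] \<phi>
      by (auto simp: algebra_simps)
    then show ?thesis using DE unfolding split by linarith
  qed
  then show "\<alpha> * A h h \<le> Broyd \<phi> A G u h h" "Broyd \<phi> A G u h h \<le> \<beta> * A h h" by auto
qed

section \<open>The residual after solving with an approximate operator\<close>

text \<open>
  The form \<open>J (K a) a\<close> is the squared dual norm of \<open>J a\<close> for \<open>G\<close>, and \<open>J a a\<close> is the one for \<open>J\<close>, so
  antimonotonicity of dual norms in the metric applies.
\<close>

lemma op_inv_form_bounds:
  fixes J G :: "'a::euclidean_space dual_op"
  assumes J: "self_adjoint J" "pos_def J" and G: "self_adjoint G" "pos_def G"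
    and \<alpha>: "0 < \<alpha>" and \<beta>: "0 < \<beta>"
    and lower: "\<And>h. \<alpha> * J h h \<le> G h h" and upper: "\<And>h. G h h \<le> \<beta> * J h h"
  defines "K \<equiv> \<lambda>a. op_inv G (J a)"
  shows "J a a / \<beta> \<le> J (K a) a" "J (K a) a \<le> J a a / \<alpha>"
proof -
  have GK: "G (K a) = J a" using G by (simp add: K_def op_inv_right)
  have JG: "dual_norm G (J a) = sqrt (J (K a) a)"
    using GK J(1) unfolding self_adjoint_def by (metis K_def dual_norm_def)
  have JJ: "dual_norm J (J a) = sqrt (J a a)"
    using J by (simp add: dual_norm_apply)
  have "dual_norm J (J a) \<le> sqrt \<beta> * dual_norm G (J a)"
    by (rule dual_norm_antimono) (use assms in auto)
  then have "J a a \<le> \<beta> * J (K a) a"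
    unfolding JG JJ by (simp flip: real_sqrt_mult)
  then show "J a a / \<beta> \<le> J (K a) a" using \<beta> by (simp add: field_simps)
  have "dual_norm G (J a) \<le> sqrt (1 / \<alpha>) * dual_norm J (J a)"
    by (rule dual_norm_antimono) (use assms in \<open>auto simp: field_simps\<close>)
  then show "J (K a) a \<le> J a a / \<alpha>"
    unfolding JG JJ by (simp flip: real_sqrt_mult)
qed

text \<open>
  With \<open>J v = G u\<close> and \<open>K = op_inv G \<circ> J\<close> one has \<open>K v = u\<close> and \<open>J u - G u = - J (v - K v)\<close>, so the
  claim is that \<open>I - K\<close> has \<open>J\<close>-operator norm at most \<open>\<kappa>\<close>. As \<open>K\<close> is self-adjoint for the inner
  product \<open>J\<close>, its quadratic form suffices, and its spectrum lies between \<open>1 / \<beta>\<close> and \<open>1 / \<alpha>\<close>.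
\<close>

lemma dual_norm_residual:
  fixes J G :: "'a::euclidean_space dual_op"
  assumes J: "self_adjoint J" "pos_def J" and G: "self_adjoint G" "pos_def G"
    and \<alpha>: "0 < \<alpha>" and \<beta>: "0 < \<beta>"
    and lower: "\<And>h. \<alpha> * J h h \<le> G h h" and upper: "\<And>h. G h h \<le> \<beta> * J h h"
    and \<kappa>: "1 - 1 / \<beta> \<le> \<kappa>" "1 / \<alpha> - 1 \<le> \<kappa>" "0 \<le> \<kappa>"
  shows "dual_norm J (J u - G u) \<le> \<kappa> * dual_norm J (G u)"
proof -
  define K where "K a = op_inv G (J a)" for a
  have GK: "G (K a) = J a" for a using G by (simp add: K_def op_inv_right)
  have K_eqI: "K a = b" if "J a = G b" for a b
    using G that by (simp add: K_def op_inv_left)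
  have K_add: "K (a + b) = K a + K b" and K_scale: "K (c *\<^sub>R a) = c *\<^sub>R K a" for a b c
    by (simp_all add: K_eqI blinfun.bilinear_simps GK)
  have K_sym: "J (K a) b = J (K b) a" for a b
  proof -
    have "J (K a) b = J b (K a)" using J by (simp add: self_adjoint_def)
    also have "\<dots> = G (K b) (K a)" by (simp add: GK)
    also have "\<dots> = G (K a) (K b)" using G by (simp add: self_adjoint_def)
    also have "\<dots> = J a (K b)" by (simp add: GK)
    also have "\<dots> = J (K b) a" using J by (simp add: self_adjoint_def)
    finally show ?thesis .
  qed
  define T where "T a b = J a b - J (K a) b" for a b
  define P where "P a b = \<kappa> * J a b" for a b
  have bound: "(T a b)\<^sup>2 \<le> P a a * P b b" for a b
  proof (rule symmetric_form_bound[of T P])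
    show "bilinear T" "bilinear P"
      by (auto simp: bilinear_def linear_iff T_def P_def blinfun.bilinear_simps K_add K_scale
          algebra_simps)
    show "T a b = T b a" for a b
      using K_sym J by (simp add: T_def self_adjoint_def)
    show "\<bar>T h h\<bar> \<le> P h h" for h
    proof -
      note b = op_inv_form_bounds[OF J G \<alpha> \<beta> lower upper, of h, folded K_def]
      have "J h h - J (K h) h \<le> (1 - 1 / \<beta>) * J h h" using b by (simp add: left_diff_distrib)
      also have "\<dots> \<le> \<kappa> * J h h" using \<kappa> J by (intro mult_right_mono) (auto simp: pos_def_nonneg)
      finally have 1: "J h h - J (K h) h \<le> \<kappa> * J h h" .
      have "J (K h) h - J h h \<le> (1 / \<alpha> - 1) * J h h" using b by (simp add: left_diff_distrib)
      also have "\<dots> \<le> \<kappa> * J h h" using \<kappa> J by (intro mult_right_mono) (auto simp: pos_def_nonneg)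
      finally show ?thesis using 1 by (simp add: T_def P_def)
    qed
  qed
  define v where "v = op_inv J (G u)"
  have Jv: "J v = G u" using J by (simp add: v_def op_inv_right)
  have Kv: "K v = u" by (rule K_eqI) (rule Jv)
  define d where "d = J (v - u) (v - u)"
  have "J (u - v) = J u - G u" by (simp add: blinfun.diff_right Jv)
  then have lhs: "dual_norm J (J u - G u) = sqrt d"
    using dual_norm_apply[OF J(2), of "u - v"] by (simp add: d_def blinfun.bilinear_simps)
  have rhs: "dual_norm J (G u) = sqrt (J v v)"
    using dual_norm_apply[OF J(2), of v] by (simp add: Jv)
  have "T v (v - u) = d" by (simp add: T_def Kv d_def blinfun.bilinear_simps)
  then have "d\<^sup>2 \<le> \<kappa>\<^sup>2 * J v v * d"
    using bound[of v "v - u"] by (simp add: P_def d_def power2_eq_square mult_ac)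
  moreover have "0 \<le> d" "0 \<le> \<kappa>\<^sup>2 * J v v" using J by (auto simp: d_def pos_def_nonneg)
  ultimately have "d \<le> \<kappa>\<^sup>2 * J v v"
    by (metis less_eq_real_def mult_right_le_imp_le power2_eq_square)
  then have "sqrt d \<le> sqrt (\<kappa>\<^sup>2 * J v v)" by simp
  then show ?thesis using \<kappa>(3) by (simp add: lhs rhs real_sqrt_mult)
qed

section \<open>Symmetry of second derivatives\<close>

text \<open>
  Only differentiability of \<open>F\<close> at the single point \<open>x\<close> is available, so the second difference cannot
  be expanded by a Taylor formula with a continuous second derivative. Instead the mean value theorem,
  applied in direction \<open>b\<close> to the increment of \<open>f\<close> in direction \<open>a\<close>, expresses it by two values of
  \<open>F\<close> near \<open>x\<close>, and both of these are close to the linear approximation.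
\<close>

lemma second_difference_bound:
  fixes f :: "'a::real_normed_vector \<Rightarrow> real" and F :: "'a \<Rightarrow> 'a \<Rightarrow>\<^sub>L real"
  assumes f: "\<And>y. (f has_derivative blinfun_apply (F y)) (at y)"
    and "bounded_linear H"
    and err: "\<And>h. norm h < \<delta> \<Longrightarrow> norm (F (x + h) - F x - H h) \<le> \<epsilon> * norm h"
    and t: "0 < t" "t * (norm a + norm b) < \<delta>" and \<epsilon>: "0 \<le> \<epsilon>"
  shows "\<bar>f (x + t *\<^sub>R a + t *\<^sub>R b) - f (x + t *\<^sub>R a) - f (x + t *\<^sub>R b) + f x - t\<^sup>2 * H a b\<bar>
    \<le> 2 * \<epsilon> * (norm a + norm b)\<^sup>2 * t\<^sup>2"
proof -
  interpret H: bounded_linear H by fact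
  define N where "N = norm a + norm b"
  have N: "0 \<le> N" "norm a \<le> N" "norm b \<le> N" by (auto simp: N_def)
  define p where "p s = f (x + t *\<^sub>R a + s *\<^sub>R b) - f (x + s *\<^sub>R b)" for s
  have deriv: "(p has_derivative (\<lambda>s. s * (F (x + t *\<^sub>R a + \<sigma> *\<^sub>R b) b - F (x + \<sigma> *\<^sub>R b) b)))
      (at \<sigma> within {0..t})" for \<sigma>
  proof -
    have "((\<lambda>s. y + s *\<^sub>R b) has_derivative (\<lambda>s. s *\<^sub>R b)) (at \<sigma> within {0..t})" for y
      by (auto intro!: derivative_eq_intros)
    note line = has_derivative_compose[OF this f]
    show ?thesis
      using has_derivative_diff[OF line[of "x + t *\<^sub>R a"] line[of x]]
      unfolding p_def[abs_def] by (simp add: blinfun.scaleR_right right_diff_distrib)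
  qed
  obtain \<sigma> where \<sigma>: "\<sigma> \<in> {0<..<t}"
    and mv: "p t - p 0 = t * (F (x + t *\<^sub>R a + \<sigma> *\<^sub>R b) b - F (x + \<sigma> *\<^sub>R b) b)"
    using mvt_simple[OF t(1) deriv] by auto
  define h where "h = t *\<^sub>R a + \<sigma> *\<^sub>R b"
  define k where "k = \<sigma> *\<^sub>R b"
  have nh: "norm h \<le> t * N"
  proof -
    have "norm h \<le> t * norm a + \<sigma> * norm b"
      using t \<sigma> norm_triangle_ineq[of "t *\<^sub>R a" "\<sigma> *\<^sub>R b"] by (simp add: h_def)
    also have "\<dots> \<le> t * norm a + t * norm b" using \<sigma> by (simp add: mult_right_mono)
    finally show ?thesis by (simp add: N_def distrib_left)
  qed
  have nk: "norm k \<le> t * N"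
  proof -
    have "norm k \<le> t * norm b" using \<sigma> by (simp add: k_def mult_right_mono)
    also have "\<dots> \<le> t * N" using t N by simp
    finally show ?thesis .
  qed
  define D where "D = (F (x + h) - F x - H h) - (F (x + k) - F x - H k)"
  have "norm (F (x + h) - F x - H h) \<le> \<epsilon> * (t * N)" "norm (F (x + k) - F x - H k) \<le> \<epsilon> * (t * N)"
    using err[of h] err[of k] nh nk t \<epsilon> unfolding N_def
    by (meson le_less_trans mult_left_mono order_trans)+
  then have nD: "norm D \<le> 2 * (\<epsilon> * (t * N))"
    unfolding D_def using norm_triangle_ineq4 by (smt (verit))
  have D: "D = F (x + h) - F (x + k) - t *\<^sub>R H a"
    by (simp add: D_def h_def k_def H.add H.scaleR)
  have "p t - p 0 - t\<^sup>2 * H a b = t * D b"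
    unfolding mv D h_def k_def
    by (simp add: blinfun.bilinear_simps algebra_simps power2_eq_square)
  then have "\<bar>p t - p 0 - t\<^sup>2 * H a b\<bar> = t * \<bar>D b\<bar>" using t by (simp add: abs_mult)
  also have "\<dots> \<le> t * (norm D * norm b)" 
    using t norm_blinfun[of D b] by (intro mult_left_mono) auto
  also have "\<dots> \<le> t * (2 * (\<epsilon> * (t * N)) * N)"
    using t nD N \<epsilon> by (intro mult_left_mono mult_mono) auto
  finally show ?thesis
    by (simp add: p_def N_def power2_eq_square algebra_simps)
qed

text \<open>
  The second difference does not change when \<open>a\<close> and \<open>b\<close> are exchanged, and it equals
  \<open>t\<^sup>2 H a b + o(t\<^sup>2)\<close>.
\<close>

lemma symmetric_second_derivative:
  fixes f :: "'a::real_normed_vector \<Rightarrow> real" and F :: "'a \<Rightarrow> 'a \<Rightarrow>\<^sub>L real"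
  assumes f: "\<And>y. (f has_derivative blinfun_apply (F y)) (at y)"
    and F: "(F has_derivative H) (at x)"
  shows "H a b = H b a"
proof (rule ccontr)
  assume ne: "H a b \<noteq> H b a"
  define d where "d = \<bar>H a b - H b a\<bar>"
  define N where "N = norm a + norm b"
  have d: "0 < d" using ne by (simp add: d_def)
  have N: "0 \<le> N" by (simp add: N_def)
  \<comment> \<open>The two expansions give \<open>d \<le> 4 \<epsilon> N\<^sup>2\<close>, which this \<open>\<epsilon>\<close> violates; the \<open>1\<close> covers \<open>N = 0\<close>.\<close>
  define \<epsilon> where "\<epsilon> = d / (8 * (N\<^sup>2 + 1))"
  have \<epsilon>: "0 < \<epsilon>" using d by (simp add: \<epsilon>_def add_nonneg_pos)
  have H: "bounded_linear H" using F by (rule has_derivative_bounded_linear)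
  obtain \<delta> where \<delta>: "0 < \<delta>"
    and err: "\<And>h. norm h < \<delta> \<Longrightarrow> norm (F (x + h) - F x - H h) \<le> \<epsilon> * norm h"
  proof -
    obtain \<delta> where "0 < \<delta>" "\<forall>y. norm (y - x) < \<delta> \<longrightarrow> norm (F y - F x - H (y - x)) \<le> \<epsilon> * norm (y - x)"
      using F \<epsilon> unfolding has_derivative_at_alt by blast
    then show thesis using that[of \<delta>] by (metis add_diff_cancel_left')
  qed
  define t where "t = \<delta> / (2 * (N + 1))"
  have t: "0 < t" using \<delta> N by (simp add: t_def)
  have "t * N < \<delta>" using \<delta> N by (simp add: t_def field_simps add_nonneg_pos)
  have bound: "\<bar>f (x + t *\<^sub>R a + t *\<^sub>R b) - f (x + t *\<^sub>R a) - f (x + t *\<^sub>R b) + f x - t\<^sup>2 * H a b\<bar>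
      \<le> 2 * \<epsilon> * (norm a + norm b)\<^sup>2 * t\<^sup>2" if "t * (norm a + norm b) < \<delta>" for a b
    by (rule second_difference_bound[OF f H _ t that]) (use err \<epsilon> in auto)
  define \<Delta> where "\<Delta> = f (x + t *\<^sub>R a + t *\<^sub>R b) - f (x + t *\<^sub>R a) - f (x + t *\<^sub>R b) + f x"
  have 1: "\<bar>\<Delta> - t\<^sup>2 * H a b\<bar> \<le> 2 * \<epsilon> * N\<^sup>2 * t\<^sup>2"
    using bound[of a b] \<open>t * N < \<delta>\<close> unfolding N_def \<Delta>_def by simp
  have 2: "\<bar>\<Delta> - t\<^sup>2 * H b a\<bar> \<le> 2 * \<epsilon> * N\<^sup>2 * t\<^sup>2"
    using bound[of b a] \<open>t * N < \<delta>\<close> unfolding N_def \<Delta>_def by (simp add: add.commute add.left_commute)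
  have "t\<^sup>2 * d = \<bar>t\<^sup>2 * H a b - t\<^sup>2 * H b a\<bar>"
    unfolding right_diff_distrib[symmetric] abs_mult d_def by simp
  also have "\<dots> \<le> t\<^sup>2 * (4 * \<epsilon> * N\<^sup>2)" using 1 2 by (auto simp: abs_le_iff algebra_simps)
  finally have "d \<le> 4 * \<epsilon> * N\<^sup>2" using t by simp
  moreover have "d = \<epsilon> * (8 * (N\<^sup>2 + 1))"
    using add_nonneg_pos[of "N\<^sup>2" 1] by (simp add: \<epsilon>_def)
  moreover have "0 \<le> \<epsilon> * N\<^sup>2" using \<epsilon> by simp
  ultimately show False using \<epsilon> by (simp add: algebra_simps)
qed

lemma hessian_self_adjoint: "twice_differentiable f \<Longrightarrow> self_adjoint (hessian f x)"
  unfolding self_adjoint_def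
  by (intro allI symmetric_second_derivative[OF twice_differentiable_gradient twice_differentiable_hessian])

section \<open>Integral means along a segment\<close>

lemma integral_form:
  fixes H :: "real \<Rightarrow> 'a::euclidean_space dual_op"
  assumes "H integrable_on S"
  shows "((\<lambda>t. H t a b) has_integral integral S H a b) S"
proof -
  have "bounded_linear (\<lambda>A::'a dual_op. A a b)"
    by (intro bounded_linear_intros blinfun.bounded_linear_left)
  from has_integral_linear[OF integrable_integral[OF assms] this]
  show ?thesis by (simp add: o_def)
qed

lemma gradient_difference:
  fixes f :: "'a::euclidean_space \<Rightarrow> real"
  assumes f: "twice_differentiable f" 
    and int: "(\<lambda>t. hessian f (x + t *\<^sub>R u)) integrable_on {0..1}"
  shows "gradient f (x + u) = gradient f x + integral {0..1} (\<lambda>t. hessian f (x + t *\<^sub>R u)) u"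
proof -
  let ?H = "\<lambda>t. hessian f (x + t *\<^sub>R u)"
  have "((\<lambda>t. gradient f (x + t *\<^sub>R u)) has_vector_derivative ?H t u) (at t within {0..1})" for t
  proof -
    have "((\<lambda>t. x + t *\<^sub>R u) has_derivative (\<lambda>s. s *\<^sub>R u)) (at t within {0..1})"
      by (auto intro!: derivative_eq_intros)
    from has_derivative_compose[OF this twice_differentiable_hessian[OF f]]
    show ?thesis by (simp add: has_vector_derivative_def blinfun.scaleR_right)
  qed
  then have "((\<lambda>t. ?H t u) has_integral gradient f (x + 1 *\<^sub>R u) - gradient f (x + 0 *\<^sub>R u)) {0..1}"
    by (intro fundamental_theorem_of_calculus) auto
  moreover have "((\<lambda>t. ?H t u) has_integral integral {0..1} ?H u) {0..1}"
    using has_integral_linear[OF integrable_integral[OF int] blinfun.bounded_linear_left[of u]]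
    by (simp add: o_def)
  ultimately have "gradient f (x + 1 *\<^sub>R u) - gradient f (x + 0 *\<^sub>R u) = integral {0..1} ?H u"
    by (rule has_integral_unique)
  then show ?thesis by (simp add: algebra_simps)
qed

text \<open>
  Since the right-hand side of the hypothesis may be evaluated at any point \<open>s\<close>, averaging over \<open>s\<close>
  first replaces \<open>q s\<close> by the mean \<open>j\<close>, and then averaging over \<open>t\<close> finishes. Dividing by \<open>1 + c t\<close>
  instead would lead to the mean of \<open>1 / (1 + c t)\<close> and to Jensen's inequality.
\<close>

lemma mean_dominates:
  fixes q c :: "real \<Rightarrow> real"
  assumes q: "(q has_integral j) {0..1}" and c: "(c has_integral m) {0..1}"
    and le: "\<And>s t. s \<in> {0..1} \<Longrightarrow> t \<in> {0..1} \<Longrightarrow> X - q t \<le> c t * q s"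
  shows "X \<le> (1 + m) * j"
proof -
  have const: "((\<lambda>_. y) has_integral y) {0..1::real}" for y :: real
    using has_integral_const_real[of y 0 1] by simp
  have step: "X - q t \<le> c t * j" if "t \<in> {0..1}" for t
    by (rule has_integral_le[OF const has_integral_mult_right[OF q]]) (use le that in auto)
  have "X - j \<le> m * j"
    by (rule has_integral_le[OF has_integral_diff[OF const q] has_integral_mult_left[OF c]])
      (use step in auto)
  then show ?thesis by (simp add: distrib_right)
qed

lemma mean_dominated:
  fixes q c :: "real \<Rightarrow> real"
  assumes q: "(q has_integral j) {0..1}" and c: "(c has_integral m) {0..1}"
    and le: "\<And>t. t \<in> {0..1} \<Longrightarrow> q t - X \<le> c t * X"
  shows "j \<le> (1 + m) * X"
proof -
  have const: "((\<lambda>_. y) has_integral y) {0..1::real}" for y :: real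
    using has_integral_const_real[of y 0 1] by simp
  have "j - X \<le> m * X"
    by (rule has_integral_le[OF has_integral_diff[OF q const] has_integral_mult_left[OF c]])
      (use le in auto)
  then show ?thesis by (simp add: distrib_right)
qed

section \<open>Strongly self-concordant functions\<close>

locale strongly_self_concordant =
  fixes f :: "'a::euclidean_space \<Rightarrow> real" and M :: real
  assumes M_nonneg: "0 \<le> M"
    and twice_diff: "twice_differentiable f"
    and hessian_pos_def: "pos_def (hessian f y)"
    and self_concordance:
      "hessian f y - hessian f v \<preceq> (M * local_norm f z (y - v)) *\<^sub>R hessian f w"
begin

lemma hessian_diff_le:
  "hessian f y h h - hessian f v h h \<le> M * local_norm f z (y - v) * hessian f w h h"
  using self_concordance[of y v z w]
  unfolding loewner_le_iff by (simp add: blinfun.bilinear_simps)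

lemma local_norm_scale: "local_norm f z (c *\<^sub>R h) = \<bar>c\<bar> * local_norm f z h"
proof -
  have "hessian f z (c *\<^sub>R h) (c *\<^sub>R h) = c\<^sup>2 * hessian f z h h"
    by (simp add: blinfun.bilinear_simps power2_eq_square)
  then show ?thesis by (simp add: local_norm_def real_sqrt_mult)
qed

lemma local_norm_nonneg: "0 \<le> local_norm f z h"
  by (simp add: local_norm_def pos_def_nonneg hessian_pos_def)

text \<open>
  Self-concordance bounds the quadratic form of the difference of two Hessians from both sides. As the
  difference is symmetric, this controls its operator norm; the only use of the estimate is that the
  Hessian is continuous and hence integrable along segments.
\<close>

lemma hessian_lipschitz_at:
  "norm (hessian f y - hessian f v)
    \<le> M * (sqrt (norm (hessian f v)) * norm (hessian f v)) * norm (y - v)"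
proof -
  define n where "n = norm (hessian f v)"
  have n: "0 \<le> n" by (simp add: n_def)
  define C where "C = M * (sqrt n * n) * norm (y - v)"
  have C: "0 \<le> C" using M_nonneg n by (simp add: C_def)
  have H_le: "hessian f v h h \<le> n * (norm h)\<^sup>2" for h
  proof -
    have "hessian f v h h \<le> norm (hessian f v h) * norm h"
      using norm_blinfun[of "hessian f v h" h] by simp
    also have "\<dots> \<le> n * norm h * norm h"
      unfolding n_def using norm_blinfun by (intro mult_right_mono) auto
    finally show ?thesis by (simp add: power2_eq_square)
  qed
  have ln: "local_norm f v (y - v) \<le> sqrt n * norm (y - v)"
    using real_sqrt_le_mono[OF H_le[of "y - v"]] by (simp add: local_norm_def real_sqrt_mult)
  define T where "T a b = (hessian f y - hessian f v) a b" for a b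
  define P where "P a b = C * (a \<bullet> b)" for a b :: 'a
  have bound: "(T a b)\<^sup>2 \<le> P a a * P b b" for a b
  proof (rule symmetric_form_bound[of T P])
    show "bilinear T" "bilinear P"
      by (auto simp: bilinear_def linear_iff T_def P_def blinfun.bilinear_simps algebra_simps)
    show "T a b = T b a" for a b
      using hessian_self_adjoint[OF twice_diff] by (simp add: T_def self_adjoint_def blinfun.bilinear_simps)
    show "\<bar>T h h\<bar> \<le> P h h" for h
    proof -
      have "local_norm f v (v - y) = local_norm f v (y - v)"
        using local_norm_scale[of v "-1" "y - v"] by simp
      then have "\<bar>T h h\<bar> \<le> M * local_norm f v (y - v) * hessian f v h h"
        using hessian_diff_le[of y h v v v] hessian_diff_le[of v h y v v]
        by (simp add: T_def blinfun.bilinear_simps)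
      also have "\<dots> \<le> M * (sqrt n * norm (y - v)) * (n * (norm h)\<^sup>2)"
        using ln H_le M_nonneg n
        by (intro mult_mono mult_left_mono) (auto simp: pos_def_nonneg hessian_pos_def)
      also have "\<dots> = P h h" by (simp add: P_def C_def power2_norm_eq_inner)
      finally show ?thesis .
    qed
  qed
  have "norm ((hessian f y - hessian f v) a) \<le> C * norm a" for a
  proof (rule norm_blinfun_bound)
    show "0 \<le> C * norm a" using C by simp
    show "norm ((hessian f y - hessian f v) a b) \<le> C * norm a * norm b" for b
    proof (rule power2_le_imp_le)
      show "(norm ((hessian f y - hessian f v) a b))\<^sup>2 \<le> (C * norm a * norm b)\<^sup>2"
        using bound[of a b]
        by (simp add: T_def P_def power_mult_distrib dot_square_norm power2_eq_square mult_ac)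
    qed (use C in simp)
  qed
  with C have "norm (hessian f y - hessian f v) \<le> C" by (rule norm_blinfun_bound)
  then show ?thesis by (simp add: C_def n_def)
qed

lemma isCont_hessian: "isCont (hessian f) v"
proof -
  have "((\<lambda>y. hessian f y - hessian f v) \<longlongrightarrow> 0) (at v)"
  proof (rule Lim_null_comparison)
    show "\<forall>\<^sub>F y in at v. norm (hessian f y - hessian f v)
        \<le> M * (sqrt (norm (hessian f v)) * norm (hessian f v)) * norm (y - v)"
      by (intro always_eventually allI hessian_lipschitz_at)
    show "((\<lambda>y. M * (sqrt (norm (hessian f v)) * norm (hessian f v)) * norm (y - v)) \<longlongrightarrow> 0) (at v)"
      by (auto intro!: tendsto_eq_intros)
  qed
  then show ?thesis unfolding isCont_def by (rule LIM_zero_cancel)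
qed

lemma hessian_segment_integrable: "(\<lambda>t. hessian f (x + t *\<^sub>R u)) integrable_on {0..1::real}"
proof (rule integrable_continuous_real, rule continuous_at_imp_continuous_on, rule ballI)
  fix t :: real
  have "isCont (\<lambda>t. x + t *\<^sub>R u) t" by simp
  from isCont_o2[OF this isCont_hessian] show "isCont (\<lambda>t. hessian f (x + t *\<^sub>R u)) t" .
qed

definition mean_hessian :: "'a \<Rightarrow> 'a \<Rightarrow> 'a dual_op" where
  "mean_hessian x u = integral {0..1} (\<lambda>t. hessian f (x + t *\<^sub>R u))"

lemma mean_hessian_form:
  "((\<lambda>t. hessian f (x + t *\<^sub>R u) a b) has_integral mean_hessian x u a b) {0..1}"
  unfolding mean_hessian_def by (rule integral_form[OF hessian_segment_integrable])

lemma gradient_step: "gradient f (x + u) = gradient f x + mean_hessian x u u"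
  unfolding mean_hessian_def
  by (rule gradient_difference[OF twice_diff hessian_segment_integrable])

lemma mean_hessian_self_adjoint: "self_adjoint (mean_hessian x u)"
  unfolding self_adjoint_def
proof (intro allI)
  fix a b
  have "((\<lambda>t. hessian f (x + t *\<^sub>R u) a b) has_integral mean_hessian x u b a) {0..1}"
  proof (rule has_integral_eq)
    show "((\<lambda>t. hessian f (x + t *\<^sub>R u) b a) has_integral mean_hessian x u b a) {0..1}"
      by (rule mean_hessian_form)
    show "hessian f (x + t *\<^sub>R u) b a = hessian f (x + t *\<^sub>R u) a b" for t
      using hessian_self_adjoint[OF twice_diff, of "x + t *\<^sub>R u"]
      unfolding self_adjoint_def by (elim allE)
  qed
  from mean_hessian_form[of x u a b] this show "mean_hessian x u a b = mean_hessian x u b a"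
    by (rule has_integral_unique)
qed

text \<open>
  At parameter \<open>t\<close> the Hessian differs from the one at \<open>x\<close> by a factor governed by \<open>t r\<close> and from the
  one at \<open>x + u\<close> by one governed by \<open>(1 - t) r\<close>, where \<open>r\<close> is the length of \<open>u\<close> measured at
  \<open>x\<close> in both cases. Both weights have mean \<open>1 / 2\<close>.
\<close>

lemma mean_hessian_bounds:
  fixes x u h :: 'a
  defines "c \<equiv> M * local_norm f x u / 2"
  shows "hessian f x h h \<le> (1 + c) * mean_hessian x u h h"
    and "mean_hessian x u h h \<le> (1 + c) * hessian f x h h"
    and "hessian f (x + u) h h \<le> (1 + c) * mean_hessian x u h h"
    and "mean_hessian x u h h \<le> (1 + c) * hessian f (x + u) h h"
proof -
  let ?r = "local_norm f x u"
  have ident: "((\<lambda>t. t) has_integral 1/2) {0..1::real}"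
    using ident_has_integral[of 0 "1::real"] by (simp add: power2_eq_square)
  have int0: "((\<lambda>t. M * ?r * t) has_integral c) {0..1}"
    using has_integral_mult_right[OF ident, of "M * ?r"] by (simp add: c_def)
  have int1: "((\<lambda>t. M * ?r * (1 - t)) has_integral c) {0..1}"
    using has_integral_mult_right[OF has_integral_diff[OF has_integral_const_real[of 1 0 1] ident], of "M * ?r"]
    by (simp add: c_def)
  have n0: "local_norm f x ((x + t *\<^sub>R u) - x) = t * ?r" "local_norm f x (x - (x + t *\<^sub>R u)) = t * ?r"
    if "t \<in> {0..1}" for t
    using that local_norm_scale[of x t u] local_norm_scale[of x "- t" u] by simp_all
  have n1: "local_norm f x ((x + u) - (x + t *\<^sub>R u)) = (1 - t) * ?r"
    "local_norm f x ((x + t *\<^sub>R u) - (x + u)) = (1 - t) * ?r"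
    if "t \<in> {0..1}" for t
    using that local_norm_scale[of x "1 - t" u] local_norm_scale[of x "t - 1" u]
    by (simp_all add: algebra_simps)
  show "hessian f x h h \<le> (1 + c) * mean_hessian x u h h"
  proof (rule mean_dominates[OF mean_hessian_form int0])
    fix s t :: real assume "t \<in> {0..1}"
    then show "hessian f x h h - hessian f (x + t *\<^sub>R u) h h
        \<le> M * ?r * t * hessian f (x + s *\<^sub>R u) h h"
      using hessian_diff_le[of x h "x + t *\<^sub>R u" x "x + s *\<^sub>R u"] n0 by (simp only: mult_ac)
  qed
  show "mean_hessian x u h h \<le> (1 + c) * hessian f x h h"
  proof (rule mean_dominated[OF mean_hessian_form int0])
    fix t :: real assume "t \<in> {0..1}"
    then show "hessian f (x + t *\<^sub>R u) h h - hessian f x h h \<le> M * ?r * t * hessian f x h h"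
      using hessian_diff_le[of "x + t *\<^sub>R u" h x x x] n0 by (simp only: mult_ac)
  qed
  show "hessian f (x + u) h h \<le> (1 + c) * mean_hessian x u h h"
  proof (rule mean_dominates[OF mean_hessian_form int1])
    fix s t :: real assume "t \<in> {0..1}"
    then show "hessian f (x + u) h h - hessian f (x + t *\<^sub>R u) h h
        \<le> M * ?r * (1 - t) * hessian f (x + s *\<^sub>R u) h h"
      using hessian_diff_le[of "x + u" h "x + t *\<^sub>R u" x "x + s *\<^sub>R u"] n1 by (simp only: mult_ac)
  qed
  show "mean_hessian x u h h \<le> (1 + c) * hessian f (x + u) h h"
  proof (rule mean_dominated[OF mean_hessian_form int1])
    fix t :: real assume "t \<in> {0..1}"
    then show "hessian f (x + t *\<^sub>R u) h h - hessian f (x + u) h h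
        \<le> M * ?r * (1 - t) * hessian f (x + u) h h"
      using hessian_diff_le[of "x + t *\<^sub>R u" h "x + u" x "x + u"] n1 by (simp only: mult_ac)
  qed
qed

lemma mean_hessian_pos_def: "pos_def (mean_hessian x u)"
  unfolding pos_def_def
proof (intro allI impI)
  fix h :: 'a assume "h \<noteq> 0"
  then have "0 < hessian f x h h" using hessian_pos_def by (simp add: pos_def_def)
  also have "\<dots> \<le> (1 + M * local_norm f x u / 2) * mean_hessian x u h h"
    by (rule mean_hessian_bounds(1))
  finally show "0 < mean_hessian x u h h"
    by (rule zero_less_mult_pos) (use M_nonneg local_norm_nonneg[of x u] in \<open>simp add: add_pos_nonneg\<close>)
qed

end

section \<open>One quasi-Newton step\<close>

context strongly_self_concordant
begin

lemma newton_decrement_nonneg: "0 \<le> newton_decrement f x"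
  by (simp add: newton_decrement_dual_norm dual_norm_nonneg hessian_pos_def)

text \<open>
  The step is \<open>u\<close>, the current approximation \<open>G\<close> satisfies two-sided bounds by the Hessian at \<open>x\<close> with
  slack \<open>\<xi>\<close>, and \<open>\<kappa>\<close> stands for the condition number \<open>L / \<mu>\<close>. Passing from the Hessian at either end of
  the step to the mean Hessian, or back, costs the factor \<open>c\<close>.
\<close>
context
  fixes x u :: 'a and G :: "'a dual_op" and \<xi> \<kappa> c :: real
  assumes G: "self_adjoint G" "pos_def G"
    and \<xi>: "1 \<le> \<xi>" and \<kappa>: "1 \<le> \<kappa>"
    and lower: "\<And>h. hessian f x h h / \<xi> \<le> G h h"
    and upper: "\<And>h. G h h \<le> \<xi> * \<kappa> * hessian f x h h"
    and u: "u = - op_inv G (gradient f x)"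
    and c: "c = 1 + M * local_norm f x u / 2"
begin

lemma c_ge_1: "1 \<le> c"
  using M_nonneg local_norm_nonneg[of x u] by (simp add: c)

lemma G_step: "G u = - gradient f x"
  using G by (simp add: u blinfun.minus_right op_inv_right)

text \<open>
  The lower bound on \<open>G\<close> gives \<open>r\<^sup>2 \<le> \<xi> G u u\<close> for the local length \<open>r\<close> of \<open>u\<close>. Here \<open>G u\<close> is minus the
  gradient, and its pairing with \<open>u\<close> is at most the Newton decrement times \<open>r\<close>.
\<close>

lemma step_length_le: "local_norm f x u \<le> \<xi> * newton_decrement f x"
proof -
  define r where "r = local_norm f x u"
  have r: "0 \<le> r" "r * r = hessian f x u u"
    by (simp_all add: r_def local_norm_def pos_def_nonneg hessian_pos_def)
  have "r * r \<le> \<xi> * G u u"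
    using lower[of u] \<xi> r by (simp add: field_simps)
  also have "G u u \<le> \<bar>gradient f x u\<bar>" by (simp add: G_step blinfun.minus_left)
  also have "\<bar>gradient f x u\<bar> \<le> newton_decrement f x * r"
    unfolding newton_decrement_dual_norm r_def local_norm_def
    by (rule dual_norm_pairing[OF hessian_self_adjoint[OF twice_diff] hessian_pos_def])
  finally have "r * r \<le> (\<xi> * newton_decrement f x) * r"
    using \<xi> by (simp add: mult_left_mono mult.assoc)
  moreover have "0 \<le> \<xi> * newton_decrement f x"
    using \<xi> newton_decrement_nonneg by simp
  ultimately show ?thesis
    using r unfolding r_def by (metis less_eq_real_def mult_right_le_imp_le)
qed

lemma mean_hessian_metric_bounds:
  shows "mean_hessian x u h h / (\<xi> * c) \<le> G h h"
    and "G h h \<le> \<xi> * c * \<kappa> * mean_hessian x u h h"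
proof -
  have "mean_hessian x u h h / (\<xi> * c) \<le> c * hessian f x h h / (\<xi> * c)"
    using mean_hessian_bounds(2)[of x u h] c_ge_1 \<xi>
    by (intro divide_right_mono) (auto simp: c)
  also have "\<dots> = hessian f x h h / \<xi>" using c_ge_1 by simp
  finally show "mean_hessian x u h h / (\<xi> * c) \<le> G h h" using lower[of h] by linarith
  have "G h h \<le> \<xi> * \<kappa> * (c * mean_hessian x u h h)"
    using mean_hessian_bounds(1)[of x h u] \<xi> \<kappa> upper[of h]
    by (intro order_trans[OF upper[of h]] mult_left_mono) (auto simp: c)
  then show "G h h \<le> \<xi> * c * \<kappa> * mean_hessian x u h h" by (simp add: mult_ac)
qed

text \<open>
  One factor \<open>c\<close> is paid for passing from the Hessian at \<open>x\<close> to the mean Hessian, the update costs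
  nothing, and a second factor \<open>c\<close> is paid for passing on to the Hessian at \<open>x + u\<close>.
\<close>

lemma Broyd_step_bounds:
  assumes "0 \<le> \<phi>" "\<phi> \<le> 1" and e: "c * c \<le> e"
  shows "hessian f (x + u) h h / (\<xi> * e) \<le> Broyd \<phi> (mean_hessian x u) G u h h"
    and "Broyd \<phi> (mean_hessian x u) G u h h \<le> \<xi> * e * \<kappa> * hessian f (x + u) h h"
proof -
  let ?J = "mean_hessian x u h h" and ?H = "hessian f (x + u) h h"
  let ?B = "Broyd \<phi> (mean_hessian x u) G u h h"
  have ge1: "1 \<le> \<xi> * c" "1 \<le> \<xi> * c * \<kappa>"
    using mult_mono[OF \<xi> c_ge_1] mult_mono[OF mult_mono[OF \<xi> c_ge_1] \<kappa>] \<xi> c_ge_1 by auto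
  have "0 < c * c" using c_ge_1 by simp
  then have e_pos: "0 < e" using e by linarith
  have H: "0 \<le> ?H" by (simp add: pos_def_nonneg hessian_pos_def)
  note update = Broyd_bounds[OF mean_hessian_self_adjoint mean_hessian_pos_def G assms(1,2)]
  have B: "1 / (\<xi> * c) * ?J \<le> ?B" "?B \<le> \<xi> * c * \<kappa> * ?J"
    by (rule update(1)[where \<beta> = "\<xi> * c * \<kappa>"]; use mean_hessian_metric_bounds ge1 in simp)
      (rule update(2)[where \<alpha> = "1 / (\<xi> * c)"]; use mean_hessian_metric_bounds ge1 in simp)
  have "?H / (\<xi> * e) \<le> ?H / (\<xi> * (c * c))"
    using H \<xi> c_ge_1 e e_pos by (intro divide_left_mono) auto
  also have "\<dots> \<le> c * ?J / (\<xi> * (c * c))"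
    using mean_hessian_bounds(3)[of x u h] \<xi> c_ge_1 by (intro divide_right_mono) (auto simp: c)
  also have "\<dots> = 1 / (\<xi> * c) * ?J" using c_ge_1 by simp
  finally show "?H / (\<xi> * e) \<le> ?B" using B by linarith
  note B(2)
  also have "\<xi> * c * \<kappa> * ?J \<le> \<xi> * c * \<kappa> * (c * ?H)"
    using mean_hessian_bounds(4)[of x u h] ge1 by (intro mult_left_mono) (auto simp: c)
  also have "\<dots> = \<xi> * \<kappa> * ?H * (c * c)" by (simp add: mult_ac)
  also have "\<dots> \<le> \<xi> * \<kappa> * ?H * e"
    using e H \<xi> \<kappa> by (intro mult_left_mono) auto
  finally show "?B \<le> \<xi> * e * \<kappa> * ?H" by (simp add: mult_ac)
qed

text \<open>
  The new gradient is \<open>J u - G u\<close> for the mean Hessian \<open>J\<close>, that is, the residual of the step. In the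
  dual norm of \<open>J\<close> it is smaller by the factor \<open>\<theta>\<close> than the old gradient \<open>- G u\<close>; the two changes of
  metric between \<open>J\<close> and the Hessians at the ends cost \<open>sqrt c\<close> each.
\<close>

lemma newton_decrement_step:
  assumes \<theta>: "1 - 1 / (\<xi> * c * \<kappa>) \<le> \<theta>" "\<xi> * c - 1 \<le> \<theta>"
  shows "newton_decrement f (x + u) \<le> c * \<theta> * newton_decrement f x"
proof -
  let ?J = "mean_hessian x u" and ?g = "gradient f x"
  have pos: "0 < c" "0 < \<xi> * c" "0 < \<xi> * c * \<kappa>" using c_ge_1 \<xi> \<kappa> by simp_all
  have "1 * 1 \<le> \<xi> * c" using \<xi> c_ge_1 by (intro mult_mono) auto
  then have \<theta>0: "0 \<le> \<theta>" using \<theta> by simp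
  have g: "gradient f (x + u) = ?J u - G u" by (simp add: gradient_step G_step)
  have "newton_decrement f (x + u) \<le> sqrt c * dual_norm ?J (?J u - G u)"
    unfolding newton_decrement_dual_norm g
    using mean_hessian_bounds(4)[of x u] pos
    by (intro dual_norm_antimono mean_hessian_self_adjoint mean_hessian_pos_def hessian_pos_def)
      (auto simp: c)
  also have "\<dots> \<le> sqrt c * (\<theta> * dual_norm ?J (G u))"
  proof (rule mult_left_mono)
    show "dual_norm ?J (?J u - G u) \<le> \<theta> * dual_norm ?J (G u)"
      by (rule dual_norm_residual[OF mean_hessian_self_adjoint mean_hessian_pos_def G,
            of "1 / (\<xi> * c)" "\<xi> * c * \<kappa>"])
        (use mean_hessian_metric_bounds pos \<theta> \<theta>0 in auto)
  qed (use pos in simp)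
  also have "dual_norm ?J (G u) = dual_norm ?J ?g"
    using dual_norm_apply[OF mean_hessian_pos_def[of x u], of "op_inv ?J (G u)"]
      dual_norm_apply[OF mean_hessian_pos_def[of x u], of "- op_inv ?J (G u)"]
    by (simp add: op_inv_right mean_hessian_pos_def G_step blinfun.minus_right blinfun.minus_left)
  also have "sqrt c * (\<theta> * dual_norm ?J ?g) \<le> sqrt c * (\<theta> * (sqrt c * newton_decrement f x))"
    unfolding newton_decrement_dual_norm
    using mean_hessian_bounds(1)[of x _ u] pos \<theta>0
    by (intro mult_left_mono dual_norm_antimono hessian_self_adjoint[OF twice_diff] mean_hessian_pos_def
        hessian_pos_def) (auto simp: c)
  also have "\<dots> = (sqrt c * sqrt c) * \<theta> * newton_decrement f x" by (simp only: mult_ac)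
  also have "sqrt c * sqrt c = c" using pos by simp
  finally show ?thesis .
qed

end

end

section \<open>Linear convergence\<close>

text \<open>
  Here \<open>\<rho> = \<mu> / L\<close>, \<open>\<tau> = M r\<^sub>k\<close> and \<open>\<eta> = \<xi>'\<^sub>k\<close>. The first factors are at most
  \<open>exp (3 \<tau> / 2) \<le> 1 / (1 - 3 \<tau> / 2)\<close>, so it suffices that the maximum is at most
  \<open>(1 - 3 \<rho> / 16) (1 - \<rho> / 2)\<close>. This expression is at least \<open>1 - 11 \<rho> / 16\<close>, while
  \<open>1 - \<rho> / \<eta> \<le> 1 - 4 \<rho> / 5\<close>, and it is at least \<open>13 / 32\<close>, while \<open>\<eta> - 1 \<le> 1 / 4\<close>.
\<close>

lemma contraction_factor_bound:
  fixes \<rho> \<tau> \<eta> :: real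
  assumes \<rho>: "0 < \<rho>" "\<rho> \<le> 1" and \<tau>: "0 \<le> \<tau>" "\<tau> \<le> \<rho> / 8" and \<eta>: "1 \<le> \<eta>" "\<eta> \<le> 5 / 4"
  shows "exp \<tau> * (1 + \<tau> / 2) * max (1 - \<rho> / \<eta>) (\<eta> - 1) \<le> 1 - \<rho> / 2"
proof -
  let ?\<theta> = "max (1 - \<rho> / \<eta>) (\<eta> - 1)"
  have "\<rho> * (4 / 5) \<le> \<rho> / \<eta>"
  proof -
    have "\<rho> * \<eta> \<le> \<rho> * (5 / 4)" using \<rho> \<eta> by (intro mult_left_mono) auto
    then show ?thesis using \<eta> by (simp add: field_simps)
  qed
  moreover have "(1 - 3 * \<rho> / 16) * (1 - \<rho> / 2) = 1 - 11 / 16 * \<rho> + 3 / 32 * (\<rho> * \<rho>)"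
    by (simp add: field_simps)
  moreover have "(13 / 16) * (1 / 2) \<le> (1 - 3 * \<rho> / 16) * (1 - \<rho> / 2)"
    using \<rho> by (intro mult_mono) auto
  moreover have "0 \<le> \<rho> * \<rho>" by simp
  ultimately have "1 - \<rho> / \<eta> \<le> (1 - 3 * \<rho> / 16) * (1 - \<rho> / 2)"
    "\<eta> - 1 \<le> (1 - 3 * \<rho> / 16) * (1 - \<rho> / 2)"
    using \<rho> \<eta> by linarith+
  then have "?\<theta> \<le> (1 - 3 * \<rho> / 16) * (1 - \<rho> / 2)" by simp
  also have "\<dots> \<le> (1 - 3 * \<tau> / 2) * (1 - \<rho> / 2)"
    using \<rho> \<tau> by (intro mult_right_mono) auto
  finally have \<theta>: "?\<theta> \<le> (1 - 3 * \<tau> / 2) * (1 - \<rho> / 2)" .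
  have "exp \<tau> * (1 + \<tau> / 2) \<le> exp \<tau> * exp (\<tau> / 2)"
    by (intro mult_left_mono exp_ge_add_one_self) auto
  also have "\<dots> = exp (3 * \<tau> / 2)" by (simp flip: exp_add)
  finally have e: "exp \<tau> * (1 + \<tau> / 2) \<le> exp (3 * \<tau> / 2)" .
  have "1 - 3 * \<tau> / 2 \<le> exp (- (3 * \<tau> / 2))"
    using exp_ge_add_one_self[of "- (3 * \<tau> / 2)"] by simp
  then have "exp (3 * \<tau> / 2) * (1 - 3 * \<tau> / 2) \<le> exp (3 * \<tau> / 2) * exp (- (3 * \<tau> / 2))"
    by (intro mult_left_mono) auto
  then have e1: "exp (3 * \<tau> / 2) * (1 - 3 * \<tau> / 2) \<le> 1" by (simp flip: exp_add)
  have "exp \<tau> * (1 + \<tau> / 2) * ?\<theta> \<le> exp (3 * \<tau> / 2) * ((1 - 3 * \<tau> / 2) * (1 - \<rho> / 2))"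
    using e \<theta> \<eta> by (intro mult_mono) auto
  also have "\<dots> = exp (3 * \<tau> / 2) * (1 - 3 * \<tau> / 2) * (1 - \<rho> / 2)" by simp
  also have "\<dots> \<le> 1 * (1 - \<rho> / 2)"
    using e1 \<rho> by (intro mult_right_mono) auto
  finally show ?thesis by simp
qed

lemma geometric_partial_sum_le:
  fixes q :: real
  assumes "0 \<le> q" "q < 1"
  shows "(\<Sum>i<n. q ^ i) \<le> 1 / (1 - q)"
proof -
  have "(\<Sum>i<n. q ^ i) = (1 - q ^ n) / (1 - q)"
    using assms by (simp add: sum_gp_strict)
  also have "\<dots> \<le> 1 / (1 - q)" using assms by (intro divide_right_mono) auto
  finally show ?thesis .
qed

theorem theorem4p1:
  fixes B :: "'a::euclidean_space dual_op"
    and \<mu> L M :: real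
    and f :: "'a \<Rightarrow> real"
    and x u :: "nat \<Rightarrow> 'a"
    and G J :: "nat \<Rightarrow> 'a dual_op"
    and \<phi> r \<xi> \<xi>' :: "nat \<Rightarrow> real"
  assumes "self_adjoint B" and "pos_def B"
    and "\<mu> > 0" and "L > 0" and "M \<ge> 0"
    and "twice_differentiable f"
    and "\<And>y. \<mu> *\<^sub>R B \<preceq> hessian f y"
    and "\<And>y. hessian f y \<preceq> L *\<^sub>R B"
    and "\<And>v y z w. hessian f y - hessian f v \<preceq> (M * local_norm f z (y - v)) *\<^sub>R hessian f w"
    and "\<And>k. 0 \<le> \<phi> k \<and> \<phi> k \<le> 1"
    and "G 0 = L *\<^sub>R B"
    and "\<And>k. x (Suc k) = x k - op_inv (G k) (gradient f (x k))"
    and "\<And>k. u k = x (Suc k) - x k"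
    and "\<And>k. J k = integral {0..1} (\<lambda>t. hessian f (x k + t *\<^sub>R u k))"
    and "\<And>k. G (Suc k) = Broyd (\<phi> k) (J k) (G k) (u k)"
    and "M * newton_decrement f (x 0) \<le> ln (3 / 2) / 4 * (\<mu> / L)"
    and "\<And>i. r i = local_norm f (x i) (u i)"
    and "\<And>k. \<xi> k = exp (M * (\<Sum>i<k. r i))"
    and "\<And>k. \<xi>' k = (1 + M * r k / 2) * exp (M * (\<Sum>i<k. r i))"
  shows "\<forall>k.
      (1 / \<xi> k) *\<^sub>R hessian f (x k) \<preceq> G k
    \<and> G k \<preceq> (\<xi> k * (L / \<mu>)) *\<^sub>R hessian f (x k)
    \<and> (1 / \<xi>' k) *\<^sub>R J k \<preceq> G k
    \<and> G k \<preceq> (\<xi>' k * (L / \<mu>)) *\<^sub>R J k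
    \<and> \<xi> k * newton_decrement f (x k) \<le> (1 - \<mu> / (2 * L)) ^ k * newton_decrement f (x 0)
    \<and> \<xi> k \<le> \<xi>' k
    \<and> \<xi>' k \<le> sqrt (3 / 2)"
proof -
  note B = assms(1,2) and \<mu> = assms(3) and L = assms(4) and M = assms(5)
    and \<phi> = assms(10) and G0 = assms(11) and x_Suc = assms(12) and u = assms(13)
    and G_Suc = assms(15) and init = assms(16) and r = assms(17)
    and \<xi> = assms(18) and \<xi>' = assms(19)
  have hessian_lower: "\<mu> * B h h \<le> hessian f y h h" and hessian_upper: "hessian f y h h \<le> L * B h h" for y h
    using assms(7,8)[of y] by (auto simp: loewner_le_iff blinfun.bilinear_simps)
  interpret strongly_self_concordant f M
  proof
    show "pos_def (hessian f y)" for y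
      unfolding pos_def_def
    proof (intro allI impI)
      fix h :: 'a assume "h \<noteq> 0"
      then have "0 < \<mu> * B h h" using B \<mu> by (simp add: pos_def_def)
      then show "0 < hessian f y h h" using hessian_lower[of h y] by linarith
    qed
  qed (fact assms)+
  have J: "J k = mean_hessian (x k) (u k)" for k
    by (simp add: assms(14) mean_hessian_def)
  define \<delta> where "\<delta> k = newton_decrement f (x k)" for k
  have \<delta>: "0 \<le> \<delta> k" for k by (simp add: \<delta>_def newton_decrement_nonneg)
  define \<rho> where "\<rho> = \<mu> / L"
  define q where "q = 1 - \<rho> / 2"
  define c where "c k = 1 + M * local_norm f (x k) (u k) / 2" for k
  have \<rho>: "0 < \<rho>" "\<rho> \<le> 1"
  proof -
    show "0 < \<rho>" using \<mu> L by (simp add: \<rho>_def)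
    obtain b :: 'a where "b \<in> Basis" using nonempty_Basis by blast
    then have "0 < B b b" using B nonzero_Basis by (auto simp: pos_def_def)
    moreover have "\<mu> * B b b \<le> L * B b b" using hessian_lower[of b 0] hessian_upper[of 0 b] by linarith
    ultimately show "\<rho> \<le> 1" using L by (simp add: \<rho>_def)
  qed
  have \<kappa>: "1 \<le> L / \<mu>" "L / \<mu> = 1 / \<rho>" using \<rho> \<mu> L by (auto simp: \<rho>_def field_simps)
  have q: "0 \<le> q" "q < 1" using \<rho> by (auto simp: q_def)
  have r_nonneg: "0 \<le> r k" for k by (simp add: r local_norm_nonneg)
  have \<xi>_ge_1: "1 \<le> \<xi> k" for k
    using M r_nonneg by (simp add: \<xi> sum_nonneg)
  have \<xi>_Suc: "\<xi> (Suc k) = \<xi> k * exp (M * r k)" for k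
    by (simp add: \<xi> distrib_left exp_add)
  have c: "c k = 1 + M * r k / 2" for k by (simp add: c_def r)
  have \<xi>'_c: "\<xi>' k = \<xi> k * c k" for k by (simp add: \<xi>' \<xi> c)
  have u_step: "u k = - op_inv (G k) (gradient f (x k))" "x (Suc k) = x k + u k" for k
    by (simp_all add: u x_Suc)
  have ln_le: "ln (3 / 2) \<le> (1 / 2 :: real)" using ln_le_minus_one[of "3 / 2 :: real"] by simp
  have \<delta>_0: "M * \<delta> 0 \<le> ln (3 / 2) / 4 * \<rho>" using init by (simp add: \<delta>_def \<rho>_def)

  \<comment> \<open>The bounds on \<open>r\<close> at all earlier steps belong to the invariant, because \<open>\<xi> k\<close> and \<open>\<xi>' k\<close> are
    controlled only through the total length of the path up to step \<open>k\<close>.\<close>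
  define metric where "metric k \<longleftrightarrow> self_adjoint (G k) \<and>
    (\<forall>h. hessian f (x k) h h / \<xi> k \<le> G k h h \<and> G k h h \<le> \<xi> k * (L / \<mu>) * hessian f (x k) h h)" for k
  define decrease where "decrease k \<longleftrightarrow> \<xi> k * \<delta> k \<le> q ^ k * \<delta> 0 \<and> (\<forall>i<k. r i \<le> q ^ i * \<delta> 0)" for k

  have G_pos: "pos_def (G k)" if "metric k" for k
    unfolding pos_def_def
  proof (intro allI impI)
    fix h :: 'a assume "h \<noteq> 0"
    then have "0 < hessian f (x k) h h / \<xi> k"
      using hessian_pos_def \<xi>_ge_1[of k] by (auto simp: pos_def_def)
    then show "0 < G k h h" using that unfolding metric_def by (meson less_le_trans)
  qed
  have r_le: "r k \<le> q ^ k * \<delta> 0" if "metric k" "decrease k" for k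
  proof -
    have "r k \<le> \<xi> k * \<delta> k"
      unfolding r \<delta>_def
      by (rule step_length_le[OF _ G_pos[OF that(1)] \<xi>_ge_1 \<kappa>(1) _ _ u_step(1) c_def])
        (use that in \<open>auto simp: metric_def\<close>)
    then show ?thesis using that by (simp add: decrease_def)
  qed
  \<comment> \<open>The lengths sum to at most \<open>2 / \<rho>\<close> times the initial decrement, and the initial condition is
    calibrated so that \<open>M\<close> times this is at most half of \<open>ln (3 / 2)\<close>.\<close>
  have \<xi>'_le: "\<xi>' k \<le> sqrt (3 / 2)" if "metric k" "decrease k" for k
  proof -
    have "(\<Sum>i<Suc k. r i) \<le> (\<Sum>i<Suc k. q ^ i * \<delta> 0)"
      using that r_le[OF that] by (intro sum_mono) (auto simp: decrease_def less_Suc_eq)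
    also have "\<dots> = (\<Sum>i<Suc k. q ^ i) * \<delta> 0" by (simp only: sum_distrib_right)
    also have "\<dots> \<le> 1 / (1 - q) * \<delta> 0"
      using q \<delta> by (intro mult_right_mono geometric_partial_sum_le)
    finally have "M * (\<Sum>i<Suc k. r i) \<le> M * (1 / (1 - q) * \<delta> 0)"
      using M by (rule mult_left_mono)
    also have "\<dots> = 2 / \<rho> * (M * \<delta> 0)" by (simp add: q_def)
    also have "\<dots> \<le> 2 / \<rho> * (ln (3 / 2) / 4 * \<rho>)" using \<delta>_0 \<rho> by (intro mult_left_mono) auto
    also have "\<dots> = ln (3 / 2) / 2" using \<rho> by simp
    finally have total: "M * (\<Sum>i<Suc k. r i) \<le> ln (3 / 2) / 2" .
    have "\<xi>' k \<le> exp (M * r k) * exp (M * (\<Sum>i<k. r i))"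
    proof -
      have "0 \<le> M * r k" using M r_nonneg by simp
      then have "1 + M * r k / 2 \<le> exp (M * r k)"
        using exp_ge_add_one_self[of "M * r k"] by linarith
      then show ?thesis unfolding \<xi>' by (rule mult_right_mono) simp
    qed
    also have "\<dots> = exp (M * (\<Sum>i<Suc k. r i))" by (simp add: distrib_left exp_add)
    also have "\<dots> \<le> exp (ln (3 / 2) / 2)" using total by simp
    also have "ln (3 / 2) / 2 = ln (sqrt (3 / 2 :: real))" by (rule ln_sqrt[symmetric]) simp
    also have "exp (ln (sqrt (3 / 2))) = sqrt (3 / 2 :: real)" by (rule exp_ln) simp
    finally show ?thesis .
  qed
  have sqrt_le: "sqrt (3 / 2) \<le> 5 / 4"
    by (rule real_le_lsqrt) (auto simp: power2_eq_square)

  have inv: "metric k \<and> decrease k" for k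
  proof (induction k)
    case 0
    have "hessian f (x 0) h h \<le> L * B h h" "L * B h h \<le> L / \<mu> * hessian f (x 0) h h" for h
      using hessian_upper hessian_lower[of h "x 0"] \<mu> L by (auto simp: field_simps)
    then have "metric 0"
      using B by (auto simp: metric_def \<xi> G0 self_adjoint_def blinfun.bilinear_simps)
    moreover have "decrease 0" by (simp add: decrease_def \<xi>)
    ultimately show ?case ..
  next
    case (Suc k)
    then have metric: "metric k" and decrease: "decrease k" by auto
    have G: "self_adjoint (G k)" "pos_def (G k)" and
      lower: "\<And>h. hessian f (x k) h h / \<xi> k \<le> G k h h" and
      upper: "\<And>h. G k h h \<le> \<xi> k * (L / \<mu>) * hessian f (x k) h h"
      using metric G_pos[OF metric] by (auto simp: metric_def)
    note here = G \<xi>_ge_1 \<kappa>(1) lower upper u_step(1) c_def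
    define \<tau> where "\<tau> = M * r k"
    have \<tau>0: "0 \<le> \<tau>" using M r_nonneg by (simp add: \<tau>_def)
    have cc: "c k * c k \<le> exp \<tau>"
    proof -
      have "c k * c k \<le> exp (\<tau> / 2) * exp (\<tau> / 2)"
        using exp_ge_add_one_self[of "\<tau> / 2"] \<tau>0 by (intro mult_mono) (auto simp: c \<tau>_def)
      then show ?thesis by (simp flip: exp_add)
    qed
    have "metric (Suc k)"
      unfolding metric_def u_step(2) \<xi>_Suc G_Suc J
      using Broyd_step_bounds[OF here, of "\<phi> k" "exp \<tau>"] \<phi>[of k] cc
        Broyd_self_adjoint[OF mean_hessian_self_adjoint G(1)]
      by (simp add: \<tau>_def)
    moreover have "decrease (Suc k)"
    proof -
      define \<theta> where "\<theta> = max (1 - \<rho> / (\<xi> k * c k)) (\<xi> k * c k - 1)"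
      have "M * r k \<le> M * (1 * \<delta> 0)"
        using r_le[OF metric decrease] q \<delta>[of 0] M
        by (intro mult_left_mono order_trans[OF r_le[OF metric decrease]] mult_right_mono power_le_one) auto
      also have "\<dots> \<le> (1 / 8) * \<rho>"
      proof -
        have "ln (3 / 2) / 4 * \<rho> \<le> (1 / 8) * \<rho>"
          using ln_le \<rho> by (intro mult_right_mono) auto
        then show ?thesis using \<delta>_0 unfolding mult_1 by (rule order_trans[rotated])
      qed
      finally have \<tau>_le: "\<tau> \<le> \<rho> / 8" by (simp add: \<tau>_def)
      have "1 \<le> \<xi> k * c k"
        using mult_mono[OF \<xi>_ge_1[of k], of 1 "c k"] c_ge_1[OF here] \<xi>_ge_1[of k] by simp
      then have factor: "exp \<tau> * (1 + \<tau> / 2) * \<theta> \<le> q"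
        using contraction_factor_bound[OF \<rho> \<tau>0 \<tau>_le, of "\<xi> k * c k"] \<xi>'_le[OF metric decrease] sqrt_le
        unfolding \<theta>_def q_def by (simp add: \<xi>'_c)
      have "\<delta> (Suc k) \<le> c k * \<theta> * \<delta> k"
        unfolding \<delta>_def u_step(2)
        by (rule newton_decrement_step[OF here]) (auto simp: \<theta>_def \<kappa>(2))
      then have "\<xi> (Suc k) * \<delta> (Suc k) \<le> \<xi> (Suc k) * (c k * \<theta> * \<delta> k)"
        using \<xi>_ge_1[of "Suc k"] by (intro mult_left_mono) auto
      also have "\<dots> = (exp \<tau> * (1 + \<tau> / 2) * \<theta>) * (\<xi> k * \<delta> k)"
        by (simp add: \<xi>_Suc \<tau>_def c)
      also have "\<dots> \<le> q * (\<xi> k * \<delta> k)"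
        using factor \<xi>_ge_1[of k] \<delta>[of k] by (intro mult_right_mono) auto
      also have "\<dots> \<le> q * (q ^ k * \<delta> 0)"
        using decrease q by (intro mult_left_mono) (auto simp: decrease_def)
      finally show ?thesis
        using decrease r_le[OF metric decrease] by (auto simp: decrease_def less_Suc_eq)
    qed
    ultimately show ?case ..
  qed

  show ?thesis
  proof (intro allI)
    fix k
    have metric: "metric k" and decrease: "decrease k" using inv by auto
    have G: "self_adjoint (G k)" "pos_def (G k)" and
      lower: "\<And>h. hessian f (x k) h h / \<xi> k \<le> G k h h" and
      upper: "\<And>h. G k h h \<le> \<xi> k * (L / \<mu>) * hessian f (x k) h h"
      using metric G_pos[OF metric] by (auto simp: metric_def)
    note here = G \<xi>_ge_1 \<kappa>(1) lower upper u_step(1) c_def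
    have "\<xi> k \<le> \<xi>' k"
      using mult_left_mono[OF c_ge_1[OF here], of "\<xi> k"] \<xi>_ge_1[of k] by (simp add: \<xi>'_c)
    moreover have "\<xi> k * newton_decrement f (x k) \<le> (1 - \<mu> / (2 * L)) ^ k * newton_decrement f (x 0)"
      using decrease by (simp add: decrease_def \<delta>_def q_def \<rho>_def mult.commute)
    ultimately show "(1 / \<xi> k) *\<^sub>R hessian f (x k) \<preceq> G k
      \<and> G k \<preceq> (\<xi> k * (L / \<mu>)) *\<^sub>R hessian f (x k)
      \<and> (1 / \<xi>' k) *\<^sub>R J k \<preceq> G k
      \<and> G k \<preceq> (\<xi>' k * (L / \<mu>)) *\<^sub>R J k
      \<and> \<xi> k * newton_decrement f (x k) \<le> (1 - \<mu> / (2 * L)) ^ k * newton_decrement f (x 0)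
      \<and> \<xi> k \<le> \<xi>' k
      \<and> \<xi>' k \<le> sqrt (3 / 2)"
      using lower upper mean_hessian_metric_bounds[OF here] \<xi>'_le[OF metric decrease]
      by (simp add: loewner_le_iff blinfun.bilinear_simps J \<xi>'_c)
  qed
qed

end
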